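(* If $\Omega$ is a hyperconvex domain in $\mathbb{C}^n$, then $$P(\overline{\Omega})\text{-hull}(K)\cap\partial\Omega=P(\overline{\Omega})\text{-hull}(K\cap\partial\Omega)\cap\partial\Omega$$ for all compact subsets $K\subset\overline{\Omega}$.
   Context: For a domain $\Omega\subset\mathbb{C}^n$, $P(\overline{\Omega})=PSH(\Omega)\cap C^0(\overline{\Omega})$ is the cone of continuous real functions on $\overline{\Omega}$ that are plurisubharmonic in $\Omega$. For a compact $K\subset\overline{\Omega}$, $P(\overline{\Omega})\text{-hull}(K)=\{z\in\overline{\Omega} : \varphi(z)\le\max_K\varphi \text{ for all } \varphi\in P(\overline{\Omega})\}$; the hull of the empty set is empty. A bounded domain $\Omega\subset\mathbb{C}^n$ is hyperconvex if it admits a continuous bounded plurisubharmonic exhaustion function, i.e., (after normalization) a continuous plurisubharmonic function $\psi:\Omega\to(-\infty,0)$ that extends continuously to $\overline{\Omega}$ by $0$ on $\partial\Omega$. *)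

theory Defs
  imports "HOL-Analysis.Analysis"
begin

(* Mean value of an extended real function over the circle of all z + exp (i t) w. It is
   meaningful when the positive part has finite integral, as is the case for a function that
   is upper semicontinuous and less than infinity on the circle. *)
definition circle_average :: "(complex ^ 'n \<Rightarrow> ereal) \<Rightarrow> complex ^ 'n \<Rightarrow> complex ^ 'n \<Rightarrow> ereal"
  where "circle_average u z w =
    (enn2ereal (\<integral>\<^sup>+ t \<in> {0..2 * pi}. e2ennreal (u (z + cis t *s w)) \<partial>lborel)
     - enn2ereal (\<integral>\<^sup>+ t \<in> {0..2 * pi}. e2ennreal (- u (z + cis t *s w)) \<partial>lborel))
    / ereal (2 * pi)"

(* Upper semicontinuous [-\<infinity>,\<infinity>)-valued functions with the sub-mean value property on every
   closed complex disc inside \<Omega>. The function identically -\<infinity> is admitted. *)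
definition plurisubharmonic_on :: "(complex ^ 'n \<Rightarrow> ereal) \<Rightarrow> (complex ^ 'n) set \<Rightarrow> bool"
  where "plurisubharmonic_on u \<Omega> \<longleftrightarrow>
    (\<forall>z\<in>\<Omega>. u z < \<infinity>) \<and>
    (\<forall>c. openin (top_of_set \<Omega>) {z \<in> \<Omega>. u z < c}) \<and>
    (\<forall>z w. (\<forall>\<zeta>. cmod \<zeta> \<le> 1 \<longrightarrow> z + \<zeta> *s w \<in> \<Omega>) \<longrightarrow> u z \<le> circle_average u z w)"

(* The cone P of the closure of \<Omega>. Its members are total functions, but only their values on
   the closure matter. *)
definition psh_cone :: "(complex ^ 'n) set \<Rightarrow> (complex ^ 'n \<Rightarrow> real) set"
  where "psh_cone \<Omega> =
    {\<phi>. continuous_on (closure \<Omega>) \<phi> \<and> plurisubharmonic_on (\<lambda>z. ereal (\<phi> z)) \<Omega>}"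

(* The supremum is a maximum when K is a nonempty compact subset of the closure of \<Omega>. *)
definition psh_hull :: "(complex ^ 'n) set \<Rightarrow> (complex ^ 'n) set \<Rightarrow> (complex ^ 'n) set"
  where "psh_hull \<Omega> K =
    (if K = {} then {}
     else {z \<in> closure \<Omega>. \<forall>\<phi>\<in>psh_cone \<Omega>. \<phi> z \<le> (SUP x\<in>K. \<phi> x)})"

(* \<psi> stands for the extension to the closure of \<Omega> of the bounded exhaustion function. *)
definition hyperconvex_domain :: "(complex ^ 'n) set \<Rightarrow> bool"
  where "hyperconvex_domain \<Omega> \<longleftrightarrow>
    open \<Omega> \<and> connected \<Omega> \<and> \<Omega> \<noteq> {} \<and> bounded \<Omega> \<and>
    (\<exists>\<psi> :: complex ^ 'n \<Rightarrow> real.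
       continuous_on (closure \<Omega>) \<psi> \<and>
       plurisubharmonic_on (\<lambda>z. ereal (\<psi> z)) \<Omega> \<and>
       (\<forall>z\<in>\<Omega>. \<psi> z < 0) \<and> (\<forall>z\<in>frontier \<Omega>. \<psi> z = 0))"

end

theory Submission
  imports Defs
begin

text \<open>Let \<open>\<psi>\<close> be the exhaustion function. For \<open>\<phi>\<close> in the cone and \<open>A \<ge> 0\<close>, the function
  \<open>\<phi> + A \<psi>\<close> is again in the cone and agrees with \<open>\<phi>\<close> on the boundary. As \<open>A\<close> grows,
  the part of \<open>K\<close> inside the domain stops contributing to its maximum over \<open>K\<close>, so that maximum
  tends to the maximum of \<open>\<phi>\<close> over the boundary part of \<open>K\<close> (to \<open>-\<infinity>\<close> if that part is empty).\<close>

lemma continuous_on_circle: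
  fixes f :: "complex ^ 'n \<Rightarrow> real"
  assumes "continuous_on \<Omega> f" and "\<forall>\<zeta>. cmod \<zeta> \<le> 1 \<longrightarrow> z + \<zeta> *s w \<in> \<Omega>"
  shows "continuous_on T (\<lambda>t. f (z + cis t *s w))"
proof (rule continuous_on_compose2[OF assms(1)])
  show "continuous_on T (\<lambda>t. z + cis t *s w)"
    unfolding vector_scalar_mult_def
    by (intro continuous_intros continuous_on_vec_lambda)
qed (use assms(2) in auto)

text \<open>A continuous function on the compact interval is integrable, so the integrals of its
  positive and negative parts are both finite. Their extended real difference in
  \<open>circle_average\<close> is then an ordinary real integral, for which linearity is
  available.\<close>

lemma circle_average_continuous:
  fixes f :: "complex ^ 'n \<Rightarrow> real"
  assumes "continuous_on {0..2 * pi} (\<lambda>t. f (z + cis t *s w))"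
  shows "circle_average (\<lambda>z. ereal (f z)) z w =
    ereal ((LINT t:{0..2 * pi}|lborel. f (z + cis t *s w)) / (2 * pi))"
proof -
  let ?g = "\<lambda>t. f (z + cis t *s w)"
  let ?h = "\<lambda>t. indicator {0..2 * pi} t *\<^sub>R ?g t"
  have int: "integrable lborel ?h"
    using borel_integrable_atLeastAtMost'[OF assms] by (simp add: set_integrable_def)
  \<comment> \<open>\<open>e2ennreal\<close> and \<open>ennreal\<close> both send negative numbers
    to 0, so this is the integral of the positive part; \<open>neg\<close> does the same for the
    negative part.\<close>
  have pos: "(\<integral>\<^sup>+ t \<in> {0..2 * pi}. e2ennreal (ereal (?g t)) \<partial>lborel) = (\<integral>\<^sup>+ t. ennreal (?h t) \<partial>lborel)"
    by (intro nn_integral_cong) (simp add: indicator_def)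
  have neg: "(\<integral>\<^sup>+ t \<in> {0..2 * pi}. e2ennreal (- ereal (?g t)) \<partial>lborel) = (\<integral>\<^sup>+ t. ennreal (- ?h t) \<partial>lborel)"
    by (intro nn_integral_cong) (simp add: indicator_def)
  have fin: "(\<integral>\<^sup>+ t. ennreal (?h t) \<partial>lborel) \<noteq> \<infinity>" "(\<integral>\<^sup>+ t. ennreal (- ?h t) \<partial>lborel) \<noteq> \<infinity>"
    using int unfolding real_integrable_def by auto
  have enn: "enn2ereal x = ereal (enn2real x)" if "x \<noteq> \<infinity>" for x
    using that by (cases x) auto
  show ?thesis
    unfolding circle_average_def pos neg enn[OF fin(1)] enn[OF fin(2)]
    unfolding set_lebesgue_integral_def real_lebesgue_integral_def[OF int]
    by simp
qed

text \<open>Finiteness and upper semicontinuity come for free from continuity, which leaves only the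
  sub-mean value inequality, now between real numbers.\<close>

lemma plurisubharmonic_on_continuous_iff:
  fixes f :: "complex ^ 'n \<Rightarrow> real"
  assumes f: "continuous_on \<Omega> f"
  shows "plurisubharmonic_on (\<lambda>z. ereal (f z)) \<Omega> \<longleftrightarrow>
    (\<forall>z w. (\<forall>\<zeta>. cmod \<zeta> \<le> 1 \<longrightarrow> z + \<zeta> *s w \<in> \<Omega>) \<longrightarrow>
      f z \<le> (LINT t:{0..2 * pi}|lborel. f (z + cis t *s w)) / (2 * pi))"
proof -
  have usc: "openin (top_of_set \<Omega>) {z \<in> \<Omega>. ereal (f z) < c}" for c
  proof -
    have "continuous_on \<Omega> (\<lambda>z. ereal (f z))"
      using f by (intro continuous_on_ereal)
    from continuous_openin_preimage_gen[OF this open_lessThan[of c]]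
    show ?thesis by (simp add: vimage_def Int_def)
  qed
  have "circle_average (\<lambda>z. ereal (f z)) z w =
      ereal ((LINT t:{0..2 * pi}|lborel. f (z + cis t *s w)) / (2 * pi))"
    if "\<forall>\<zeta>. cmod \<zeta> \<le> 1 \<longrightarrow> z + \<zeta> *s w \<in> \<Omega>" for z w
    using that
    by (intro circle_average_continuous continuous_on_circle[OF f])
  then show ?thesis
    unfolding plurisubharmonic_on_def using usc by auto
qed

text \<open>The circle integral is linear, and multiplying the inequality for \<psi> by
  \<open>A\<close> keeps its direction because \<open>A\<close> is nonnegative.\<close>

lemma psh_cone_add_scaled:
  fixes \<phi> \<psi> :: "complex ^ 'n \<Rightarrow> real"
  assumes \<phi>: "\<phi> \<in> psh_cone \<Omega>" and \<psi>: "\<psi> \<in> psh_cone \<Omega>" and "0 \<le> A"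
  shows "(\<lambda>z. \<phi> z + A * \<psi> z) \<in> psh_cone \<Omega>"
proof -
  have c: "continuous_on (closure \<Omega>) \<phi>" "continuous_on (closure \<Omega>) \<psi>"
    using \<phi> \<psi> by (auto simp: psh_cone_def)
  have csum: "continuous_on (closure \<Omega>) (\<lambda>z. \<phi> z + A * \<psi> z)"
    by (intro continuous_intros c)
  have c': "continuous_on \<Omega> \<phi>" "continuous_on \<Omega> \<psi>" "continuous_on \<Omega> (\<lambda>z. \<phi> z + A * \<psi> z)"
    using c csum closure_subset continuous_on_subset by blast+
  have "\<phi> z + A * \<psi> z \<le>
      (LINT t:{0..2 * pi}|lborel. \<phi> (z + cis t *s w) + A * \<psi> (z + cis t *s w)) / (2 * pi)"
    if disc: "\<forall>\<zeta>. cmod \<zeta> \<le> 1 \<longrightarrow> z + \<zeta> *s w \<in> \<Omega>" for z w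
  proof -
    let ?I = "\<lambda>f. LINT t:{0..2 * pi}|lborel. f (z + cis t *s w)"
    have int: "set_integrable lborel {0..2 * pi} (\<lambda>t. f (z + cis t *s w))"
      if "continuous_on \<Omega> f" for f :: "complex ^ 'n \<Rightarrow> real"
      using continuous_on_circle[OF that disc] by (rule borel_integrable_atLeastAtMost')
    have "?I (\<lambda>z. \<phi> z + A * \<psi> z) = ?I \<phi> + A * ?I \<psi>"
      by (simp add: int c' set_integral_add)
    moreover have "\<phi> z \<le> ?I \<phi> / (2 * pi)" "\<psi> z \<le> ?I \<psi> / (2 * pi)"
      using \<phi> \<psi> disc plurisubharmonic_on_continuous_iff[OF c'(1)]
        plurisubharmonic_on_continuous_iff[OF c'(2)]
      by (auto simp: psh_cone_def)
    ultimately show ?thesis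
      using mult_left_mono[OF _ \<open>0 \<le> A\<close>, of "\<psi> z" "?I \<psi> / (2 * pi)"]
      by (simp add: add_divide_distrib)
  qed
  then show ?thesis
    using csum plurisubharmonic_on_continuous_iff[OF c'(3)] by (simp add: psh_cone_def)
qed

text \<open>On the compact set where \<phi> is at least \<open>M\<close>, the strict inequality in
  \<open>zero\<close> excludes zeros of \<psi>. The quotient of \<phi> - \<open>M\<close> by -\<psi>
  is therefore continuous and bounded there, and a nonnegative upper bound serves as
  \<open>A\<close>. Elsewhere in \<open>K\<close> the penalty term only lowers \<phi>.\<close>

lemma compact_penalty_bound:
  fixes \<phi> \<psi> :: "'a::topological_space \<Rightarrow> real"
  assumes K: "compact K" and \<phi>: "continuous_on K \<phi>" and \<psi>: "continuous_on K \<psi>"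
    and nonpos: "\<And>x. x \<in> K \<Longrightarrow> \<psi> x \<le> 0"
    and zero: "\<And>x. x \<in> K \<Longrightarrow> \<psi> x = 0 \<Longrightarrow> \<phi> x < M"
  obtains A where "0 \<le> A" "\<And>x. x \<in> K \<Longrightarrow> \<phi> x + A * \<psi> x \<le> M"
proof -
  define L where "L = {x \<in> K. M \<le> \<phi> x}"
  have LK: "L \<subseteq> K" by (auto simp: L_def)
  have "closedin (top_of_set K) L"
    using continuous_closedin_preimage[OF \<phi> closed_atLeast[of M]]
    by (simp add: L_def vimage_def Int_def)
  then have L: "compact L" by (rule closedin_compact[OF K])
  have neg: "\<psi> x < 0" if "x \<in> L" for x
    using that nonpos[of x] zero[of x] by (fastforce simp: L_def)
  have "continuous_on L (\<lambda>x. (\<phi> x - M) / - \<psi> x)"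
    using neg by (intro continuous_intros continuous_on_subset[OF \<phi> LK]
        continuous_on_subset[OF \<psi> LK]) force
  then have "bdd_above ((\<lambda>x. (\<phi> x - M) / - \<psi> x) ` L)"
    by (intro bounded_imp_bdd_above compact_imp_bounded compact_continuous_image L)
  then obtain B where B: "\<And>x. x \<in> L \<Longrightarrow> (\<phi> x - M) / - \<psi> x \<le> B"
    by (auto simp: bdd_above_def)
  show thesis
  proof
    \<comment> \<open>The maximum with 0 covers the case of empty \<open>L\<close>, where
      \<open>B\<close> is arbitrary and may be negative.\<close>
    show "0 \<le> max 0 B" by simp
    fix x assume x: "x \<in> K"
    show "\<phi> x + max 0 B * \<psi> x \<le> M"
    proof (cases "x \<in> L")
      case True
      have "\<phi> x - M \<le> B * - \<psi> x"
        using B[OF True] neg[OF True] pos_divide_le_eq[of "- \<psi> x" "\<phi> x - M" B] by simp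
      also have "\<dots> \<le> max 0 B * - \<psi> x"
        using neg[OF True] by (intro mult_right_mono) auto
      finally show ?thesis by simp
    next
      case False
      then have "\<phi> x \<le> M" using x by (simp add: L_def)
      moreover have "max 0 B * \<psi> x \<le> 0"
        using nonpos[OF x] by (intro mult_nonneg_nonpos) auto
      ultimately show ?thesis by simp
    qed
  qed
qed

text \<open>Real suprema can be compared only over sets bounded above; compactness of
  \<open>K\<close> supplies this.\<close>

lemma bdd_above_psh_cone_image:
  assumes "compact K" "K \<subseteq> closure \<Omega>" "\<phi> \<in> psh_cone \<Omega>"
  shows "bdd_above (\<phi> ` K)"
proof -
  have "continuous_on K \<phi>"
    using assms(2,3) continuous_on_subset by (auto simp: psh_cone_def)
  then show ?thesis
    using assms(1) by (intro bounded_imp_bdd_above compact_imp_bounded compact_continuous_image)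
qed

lemma psh_hull_mono:
  assumes "compact K" "K \<subseteq> closure \<Omega>" "L \<subseteq> K"
  shows "psh_hull \<Omega> L \<subseteq> psh_hull \<Omega> K"
proof (cases "L = {}")
  case False
  have "(SUP x\<in>L. \<phi> x) \<le> (SUP x\<in>K. \<phi> x)" if "\<phi> \<in> psh_cone \<Omega>" for \<phi>
    using False assms(3) bdd_above_psh_cone_image[OF assms(1,2) that]
    by (intro cSUP_subset_mono) auto
  then show ?thesis
    using False assms(3) by (auto simp: psh_hull_def intro: order_trans)
qed (simp add: psh_hull_def)

theorem proposition5p1:
  fixes \<Omega> K :: "(complex ^ 'n) set"
  assumes "hyperconvex_domain \<Omega>"
    and "compact K" and "K \<subseteq> closure \<Omega>"
  shows "psh_hull \<Omega> K \<inter> frontier \<Omega> = psh_hull \<Omega> (K \<inter> frontier \<Omega>) \<inter> frontier \<Omega>"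
proof
  obtain \<psi> where "open \<Omega>" and \<psi>: "\<psi> \<in> psh_cone \<Omega>"
    and neg: "\<And>z. z \<in> \<Omega> \<Longrightarrow> \<psi> z < 0" and zero: "\<And>z. z \<in> frontier \<Omega> \<Longrightarrow> \<psi> z = 0"
    using assms(1) unfolding hyperconvex_domain_def psh_cone_def by blast
  have split: "z \<in> \<Omega> \<or> z \<in> frontier \<Omega>" if "z \<in> K" for z
    using that assms(3) \<open>open \<Omega>\<close> by (auto simp: frontier_def interior_open)
  \<comment> \<open>The hull condition is tested on \<phi> + \<open>A\<close> \<psi>, with
    \<open>A\<close> so large that this function is at most \<open>M\<close> on all of
    \<open>K\<close>. Since \<psi> vanishes at the boundary point \<open>z\<close>, the bound passes
    to \<phi> itself.\<close>
  have key: "\<phi> z \<le> M"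
    if z: "z \<in> psh_hull \<Omega> K" "z \<in> frontier \<Omega>" and \<phi>: "\<phi> \<in> psh_cone \<Omega>"
      and M: "\<And>x. x \<in> K \<inter> frontier \<Omega> \<Longrightarrow> \<phi> x < M" for z \<phi> M
  proof -
    have "continuous_on K \<phi>" "continuous_on K \<psi>"
      using \<phi> \<psi> assms(3) continuous_on_subset by (auto simp: psh_cone_def)
    moreover have "\<psi> x \<le> 0" "\<psi> x = 0 \<Longrightarrow> \<phi> x < M" if "x \<in> K" for x
      using that split[OF that] neg[of x] zero[of x] M[of x] by auto
    ultimately obtain A where A: "0 \<le> A" "\<And>x. x \<in> K \<Longrightarrow> \<phi> x + A * \<psi> x \<le> M"
      using compact_penalty_bound[OF assms(2)] by metis
    have K: "K \<noteq> {}" using z(1) by (auto simp: psh_hull_def)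
    have "\<phi> z + A * \<psi> z \<le> (SUP x\<in>K. \<phi> x + A * \<psi> x)"
      using z(1) K psh_cone_add_scaled[OF \<phi> \<psi> A(1)] by (auto simp: psh_hull_def)
    also have "\<dots> \<le> M" using K A(2) by (rule cSUP_least)
    finally show ?thesis using zero[OF z(2)] by simp
  qed
  show "psh_hull \<Omega> K \<inter> frontier \<Omega> \<subseteq> psh_hull \<Omega> (K \<inter> frontier \<Omega>) \<inter> frontier \<Omega>"
  proof
    fix z assume "z \<in> psh_hull \<Omega> K \<inter> frontier \<Omega>"
    then have z: "z \<in> psh_hull \<Omega> K" "z \<in> frontier \<Omega>" by auto
    have "K \<inter> frontier \<Omega> \<noteq> {}"
    proof
      assume "K \<inter> frontier \<Omega> = {}"
      \<comment> \<open>With no boundary points in \<open>K\<close> the assumption on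
        \<open>M\<close> in \<open>key\<close> is vacuous, so any negative \<open>M\<close>
        contradicts the vanishing of \<psi> at \<open>z\<close>.\<close>
      then have "\<psi> z \<le> - 1" by (intro key[OF z \<psi>]) auto
      then show False using zero[OF z(2)] by simp
    qed
    moreover have "\<phi> z \<le> (SUP x\<in>K \<inter> frontier \<Omega>. \<phi> x)" if \<phi>: "\<phi> \<in> psh_cone \<Omega>" for \<phi>
    \<comment> \<open>\<open>key\<close> asks for a strict bound on the boundary part, whereas the
      supremum may be attained there; the slack \<open>e\<close> makes it strict.\<close>
    proof (rule field_le_epsilon)
      fix e :: real assume "0 < e"
      have "bdd_above (\<phi> ` (K \<inter> frontier \<Omega>))"
        using bdd_above_psh_cone_image[OF assms(2,3) \<phi>] by (rule bdd_above_mono) auto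
      then have "\<phi> x < (SUP x\<in>K \<inter> frontier \<Omega>. \<phi> x) + e" if "x \<in> K \<inter> frontier \<Omega>" for x
        using cSUP_upper[OF that] \<open>0 < e\<close> by fastforce
      then show "\<phi> z \<le> (SUP x\<in>K \<inter> frontier \<Omega>. \<phi> x) + e"
        by (rule key[OF z \<phi>])
    qed
    ultimately show "z \<in> psh_hull \<Omega> (K \<inter> frontier \<Omega>) \<inter> frontier \<Omega>"
      using z by (auto simp: psh_hull_def frontier_def)
  qed
  show "psh_hull \<Omega> (K \<inter> frontier \<Omega>) \<inter> frontier \<Omega> \<subseteq> psh_hull \<Omega> K \<inter> frontier \<Omega>"
    using psh_hull_mono[OF assms(2,3)] by blast
qed

end
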